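(* Let $Y$ be a (nonzero) Banach space. Then for every $\varepsilon\in(0,1)$, $$\inf\bigl\{\tilde\eta(X,Y)(\varepsilon): X\text{ is a uniformly smooth Banach space}\bigr\}=0.$$
   Context: Banach spaces are over $\mathbb{K}$, where $\mathbb{K}=\mathbb{R}$ or $\mathbb{K}=\mathbb{C}$. $\mathcal{L}(X,Y)$ is the Banach space of bounded linear operators from $X$ to $Y$; $S_Z$ denotes the unit sphere of $Z$. For $\varepsilon\in(0,1)$, the modulus of the pointwise BPB property $\tilde\eta(X,Y)(\varepsilon)\in[0,+\infty]$ is the supremum of the set consisting of $0$ and all $\rho>0$ such that for all $T\in S_{\mathcal{L}(X,Y)}$ and $x_0\in S_X$ with $\|T(x_0)\|>1-\rho$ there is $S\in S_{\mathcal{L}(X,Y)}$ with $\|S(x_0)\|=1$ and $\|S-T\|<\varepsilon$. Uniformly smooth means $\lim_{t\to0^+}\rho_X(t)/t=0$, where $\rho_X(t)=\sup\{\frac{\|x+y\|+\|x-y\|-2}{2}: \|x\|=1,\ \|y\|\leq t\}$ for $0<t\leq 1$. *)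

theory Defs
  imports "HOL-Analysis.Analysis" "HOL-Algebra.Module"
begin

text \<open>
  The infimum in the theorem ranges over a collection of Banach spaces, and the scalar field may be
  real or complex. Banach spaces are therefore carrier-based: modules in the sense of HOL-Algebra
  together with a norm. The scalar field is a set K of complex numbers, to be
  instantiated with \<open>\<real>\<close> or UNIV. The ring multiplication and unit that the record
  type module inherits from ring carry no meaning for a module.
\<close>

definition scalars :: "complex set \<Rightarrow> complex ring" where
  "scalars K = \<lparr>carrier = K, mult = (*), one = 1, zero = 0, add = (+)\<rparr>"

record 'a normed_module = "(complex, 'a) module" +
  nrm :: "'a \<Rightarrow> real"

locale normed_space = Module.module "scalars K" X
  for K :: "complex set" and X :: "'a normed_module" +
  assumes nrm_eq_0_iff: "x \<in> carrier X \<Longrightarrow> nrm X x = 0 \<longleftrightarrow> x = \<zero>\<^bsub>X\<^esub>"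
    and nrm_smult: "k \<in> K \<Longrightarrow> x \<in> carrier X \<Longrightarrow> nrm X (k \<odot>\<^bsub>X\<^esub> x) = cmod k * nrm X x"
    and nrm_triangle:
      "x \<in> carrier X \<Longrightarrow> y \<in> carrier X \<Longrightarrow> nrm X (x \<oplus>\<^bsub>X\<^esub> y) \<le> nrm X x + nrm X y"
    and nrm_nonneg: "x \<in> carrier X \<Longrightarrow> 0 \<le> nrm X x"

text \<open>The locale Metric_space requires nonnegativity and symmetry also off the carrier; hence the
  default value 0 there.\<close>

definition nrm_dist :: "'a normed_module \<Rightarrow> 'a \<Rightarrow> 'a \<Rightarrow> real" where
  "nrm_dist X x y = (if x \<in> carrier X \<and> y \<in> carrier X then nrm X (x \<ominus>\<^bsub>X\<^esub> y) else 0)"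

locale banach_space = normed_space K X
  for K :: "complex set" and X :: "'a normed_module" +
  assumes complete: "Metric_space.mcomplete (carrier X) (nrm_dist X)"

definition unit_sphere :: "'a normed_module \<Rightarrow> 'a set" where
  "unit_sphere X = {x \<in> carrier X. nrm X x = 1}"

definition bounded_operators ::
    "complex set \<Rightarrow> 'a normed_module \<Rightarrow> 'b normed_module \<Rightarrow> ('a \<Rightarrow> 'b) set" where
  "bounded_operators K X Y = {T \<in> carrier X \<rightarrow>\<^sub>E carrier Y.
     (\<forall>x\<in>carrier X. \<forall>y\<in>carrier X. T (x \<oplus>\<^bsub>X\<^esub> y) = T x \<oplus>\<^bsub>Y\<^esub> T y) \<and>
     (\<forall>k\<in>K. \<forall>x\<in>carrier X. T (k \<odot>\<^bsub>X\<^esub> x) = k \<odot>\<^bsub>Y\<^esub> T x) \<and>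
     (\<exists>C. \<forall>x\<in>carrier X. nrm Y (T x) \<le> C * nrm X x)}"

definition op_norm :: "'a normed_module \<Rightarrow> 'b normed_module \<Rightarrow> ('a \<Rightarrow> 'b) \<Rightarrow> real" where
  "op_norm X Y T = (SUP x\<in>{x \<in> carrier X. nrm X x \<le> 1}. nrm Y (T x))"

definition op_diff ::
    "'a normed_module \<Rightarrow> 'b normed_module \<Rightarrow> ('a \<Rightarrow> 'b) \<Rightarrow> ('a \<Rightarrow> 'b) \<Rightarrow> 'a \<Rightarrow> 'b" where
  "op_diff X Y S T = (\<lambda>x\<in>carrier X. S x \<ominus>\<^bsub>Y\<^esub> T x)"

definition operator_sphere ::
    "complex set \<Rightarrow> 'a normed_module \<Rightarrow> 'b normed_module \<Rightarrow> ('a \<Rightarrow> 'b) set" where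
  "operator_sphere K X Y = {T \<in> bounded_operators K X Y. op_norm X Y T = 1}"

definition pointwise_BPB_modulus ::
    "complex set \<Rightarrow> 'a normed_module \<Rightarrow> 'b normed_module \<Rightarrow> real \<Rightarrow> ennreal" where
  "pointwise_BPB_modulus K X Y \<epsilon> = Sup (insert 0 {ennreal \<rho> | \<rho>. \<rho> > 0 \<and>
     (\<forall>T\<in>operator_sphere K X Y. \<forall>x\<^sub>0\<in>unit_sphere X. nrm Y (T x\<^sub>0) > 1 - \<rho> \<longrightarrow>
       (\<exists>S\<in>operator_sphere K X Y. nrm Y (S x\<^sub>0) = 1 \<and> op_norm X Y (op_diff X Y S T) < \<epsilon>))})"

text \<open>On the zero space the supremum is over the empty set and hence unspecified. This is
  harmless here: with the zero space as domain the operator sphere is empty, so the modulus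
  above is infinite and does not affect an infimum.\<close>

definition modulus_of_smoothness :: "'a normed_module \<Rightarrow> real \<Rightarrow> real" where
  "modulus_of_smoothness X t =
     Sup {(nrm X (x \<oplus>\<^bsub>X\<^esub> y) + nrm X (x \<ominus>\<^bsub>X\<^esub> y) - 2) / 2 | x y.
       x \<in> carrier X \<and> y \<in> carrier X \<and> nrm X x = 1 \<and> nrm X y \<le> t}"

definition uniformly_smooth :: "'a normed_module \<Rightarrow> bool" where
  "uniformly_smooth X \<longleftrightarrow> ((\<lambda>t. modulus_of_smoothness X t / t) \<longlongrightarrow> 0) (at_right 0)"

text \<open>A single proposition cannot quantify over all types, so the theorem collects the Banach
  spaces whose carrier is a set of elements of a type \<open>'u\<close>, where \<open>'u\<close> is an
  arbitrary type that is large enough to hold a nonzero Banach space, that is, of cardinality at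
  least that of the continuum.\<close>

definition at_least_continuum :: "'u itself \<Rightarrow> bool" where
  "at_least_continuum _ \<longleftrightarrow> (\<exists>f :: real \<Rightarrow> 'u. inj f)"

end

theory Submission
  imports Defs
begin

text \<open>Take for X the plane over K with a uniformly smooth norm N close to the \<open>\<ell>\<^sub>1\<close> norm. Let
  \<open>T (a, b) = (a + b) y\<^sub>0\<close> with \<open>y\<^sub>0\<close> a unit vector, and let \<open>x\<^sub>0\<close> be the normalisation of
  \<open>(1, -r)\<close> for a small \<open>r > 0\<close>. Then T nearly attains its norm at \<open>x\<^sub>0\<close>. If S has norm 1 and
  \<open>\<parallel>S - T\<parallel> < \<epsilon>\<close>, then \<open>T (1, -1) = 0\<close> gives \<open>\<parallel>S (1, -1)\<parallel> < 2 \<epsilon>\<close>, and so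
  \<open>\<parallel>S (1, -r)\<parallel> \<le> r \<parallel>S (1, -1)\<parallel> + (1 - r) \<parallel>S (1, 0)\<parallel>\<close> is, up to the distance of N from the
  \<open>\<ell>\<^sub>1\<close> norm, less than \<open>2 r \<epsilon> + 1 - r < 1 + r \<le> N (1, -r)\<close>. Hence S does not attain its norm
  at \<open>x\<^sub>0\<close>.\<close>

section \<open>Scalars and the cardinality of the plane\<close>

text \<open>Isolates what \<open>\<real>\<close> and \<open>UNIV\<close> share, so that the case
  distinction on \<open>K\<close> is made once, here.\<close>

lemma real_closed_subfield:
  fixes K :: "complex set"
  assumes "K = \<real> \<or> K = UNIV"
  shows "of_real r \<in> K" and "closed K"
    and "a \<in> K \<Longrightarrow> b \<in> K \<Longrightarrow> a + b \<in> K"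
    and "a \<in> K \<Longrightarrow> b \<in> K \<Longrightarrow> a - b \<in> K"
    and "a \<in> K \<Longrightarrow> b \<in> K \<Longrightarrow> a * b \<in> K"
    and "a \<in> K \<Longrightarrow> - a \<in> K"
  using assms closed_complex_Reals by auto

text \<open>A pair of complex numbers consists of four reals, and three uses of an injection of
  \<open>real \<times> real\<close> into \<open>real\<close> compress these to one.\<close>

lemma ex_inj_pairs:
  assumes "at_least_continuum TYPE('u)"
  shows "\<exists>\<phi> :: complex \<times> complex \<Rightarrow> 'u. inj \<phi>"
proof -
  have real: "\<exists>f :: real \<times> real \<Rightarrow> real. inj f"
    using card_of_ordLeq[of "UNIV \<times> UNIV :: (real \<times> real) set" "UNIV :: real set"]
      card_of_Times_same_infinite[of "UNIV :: real set"] infinite_UNIV_char_0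
      ordIso_imp_ordLeq by (auto simp: UNIV_Times_UNIV)
  then obtain f :: "real \<times> real \<Rightarrow> real" where f: "inj f" by blast
  obtain g :: "real \<Rightarrow> 'u" where g: "inj g"
    using assms by (auto simp: at_least_continuum_def)
  have "inj (\<lambda>z. g (f (f (Re (fst z), Im (fst z)), f (Re (snd z), Im (snd z)))))"
    using f g by (auto intro!: injI simp: inj_eq prod_eq_iff complex_eq_iff)
  then show ?thesis by blast
qed

section \<open>A uniformly smooth norm close to the \<open>\<ell>\<^sub>1\<close> norm\<close>

text \<open>The source of all smoothness below: by the parallelogram law the terms of first order in
  \<open>y\<close> cancel, and the excess over \<open>2 * norm x\<close> is quadratic in
  \<open>norm y\<close>.\<close>

lemma norm_add_diff_le:
  fixes x y :: "'a::real_inner"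
  assumes "x \<noteq> 0"
  shows "norm (x + y) + norm (x - y) \<le> 2 * norm x + (norm y)\<^sup>2 / norm x"
proof (rule power2_le_imp_le)
  have nx: "norm x > 0" using assms by simp
  have par: "(norm (x + y))\<^sup>2 + (norm (x - y))\<^sup>2 = 2 * (norm x)\<^sup>2 + 2 * (norm y)\<^sup>2"
    by (simp add: power2_norm_eq_inner inner_add inner_diff inner_commute)
  \<comment> \<open>The parallelogram identity for the two real numbers \<open>norm (x + y)\<close>
    and \<open>norm (x - y)\<close> turns control of their squares into control of their
    sum.\<close>
  have "(norm (x + y) + norm (x - y))\<^sup>2 + (norm (x + y) - norm (x - y))\<^sup>2
      = 2 * ((norm (x + y))\<^sup>2 + (norm (x - y))\<^sup>2)"
    by (simp add: power2_eq_square algebra_simps)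
  then have "(norm (x + y) + norm (x - y))\<^sup>2 \<le> 4 * (norm x)\<^sup>2 + 4 * (norm y)\<^sup>2"
    using par zero_le_power2[of "norm (x + y) - norm (x - y)"] by (smt (verit))
  \<comment> \<open>The added term completes the square.\<close>
  also have "\<dots> \<le> 4 * (norm x)\<^sup>2 + 4 * (norm y)\<^sup>2 + ((norm y)\<^sup>2 / norm x)\<^sup>2"
    by simp
  also have "\<dots> = (2 * norm x + (norm y)\<^sup>2 / norm x)\<^sup>2"
    using nx by (simp add: power2_sum)
  finally show "(norm (x + y) + norm (x - y))\<^sup>2 \<le> (2 * norm x + (norm y)\<^sup>2 / norm x)\<^sup>2" .
qed simp

text \<open>Composing the Euclidean norm with this map gives a weighted Hilbert norm. Its underlying
  real inner product makes \<open>norm_add_diff_le\<close> applicable for real and complex scalars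
  alike.\<close>

definition diag :: "real \<Rightarrow> real \<Rightarrow> complex \<times> complex \<Rightarrow> complex \<times> complex" where
  "diag p q z = (p *\<^sub>R fst z, q *\<^sub>R snd z)"

text \<open>A sum of two Hilbert space norms is uniformly smooth; as q tends to 0, this one tends to the
  \<open>\<ell>\<^sub>1\<close> norm.\<close>

definition pair_norm :: "real \<Rightarrow> complex \<times> complex \<Rightarrow> real" where
  "pair_norm q z = norm (diag (sqrt (1 - q\<^sup>2)) q z) + norm (diag q (sqrt (1 - q\<^sup>2)) z)"

lemma diag_add: "diag p q (x + y) = diag p q x + diag p q y"
  and diag_diff: "diag p q (x - y) = diag p q x - diag p q y"
  by (simp_all add: diag_def algebra_simps)

lemma norm_diag: "norm (diag p q z) = sqrt (p\<^sup>2 * (cmod (fst z))\<^sup>2 + q\<^sup>2 * (cmod (snd z))\<^sup>2)"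
  by (simp add: diag_def norm_prod_def power_mult_distrib)

lemma norm_diag_le:
  assumes "0 \<le> p" "0 \<le> q"
  shows "norm (diag p q z) \<le> p * cmod (fst z) + q * cmod (snd z)"
  using norm_Pair_le[of "p *\<^sub>R fst z" "q *\<^sub>R snd z"] assms by (simp add: diag_def)

text \<open>As the weights \<open>p\<^sup>2\<close> and \<open>q\<^sup>2\<close> sum to 1, this
  compares a mean with the root of the mean of squares; the gap between their squares is the
  variance \<open>p\<^sup>2 * q\<^sup>2 * (a - b)\<^sup>2\<close>.\<close>

lemma norm_diag_ge:
  assumes "p\<^sup>2 + q\<^sup>2 = 1"
  shows "p\<^sup>2 * cmod (fst z) + q\<^sup>2 * cmod (snd z) \<le> norm (diag p q z)"
proof -
  define a b where "a = cmod (fst z)" and "b = cmod (snd z)"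
  have "(p\<^sup>2 * a + q\<^sup>2 * b)\<^sup>2 + p\<^sup>2 * q\<^sup>2 * (a - b)\<^sup>2
      = (p\<^sup>2 + q\<^sup>2) * (p\<^sup>2 * a\<^sup>2 + q\<^sup>2 * b\<^sup>2)"
    by (simp add: power2_eq_square algebra_simps)
  moreover have "0 \<le> p\<^sup>2 * q\<^sup>2 * (a - b)\<^sup>2" by simp
  ultimately have "(p\<^sup>2 * a + q\<^sup>2 * b)\<^sup>2 \<le> p\<^sup>2 * a\<^sup>2 + q\<^sup>2 * b\<^sup>2"
    unfolding assms by (smt (verit) mult_1)
  then show ?thesis
    unfolding norm_diag a_def b_def by (rule real_le_rsqrt)
qed

text \<open>The smaller weight \<open>q\<close> bounds both Hilbert norms below. This keeps the
  denominator in \<open>norm_add_diff_le\<close> away from 0.\<close>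

lemma norm_diag_ge_min:
  assumes "0 \<le> q" "q \<le> p"
  shows "q * norm z \<le> norm (diag p q z)" and "q * norm z \<le> norm (diag q p z)"
proof -
  have "q\<^sup>2 \<le> p\<^sup>2" using assms by (simp add: power_mono)
  then have "q\<^sup>2 * (cmod w)\<^sup>2 \<le> p\<^sup>2 * (cmod w)\<^sup>2" for w by (simp add: mult_right_mono)
  moreover have "q * norm z = sqrt (q\<^sup>2 * (cmod (fst z))\<^sup>2 + q\<^sup>2 * (cmod (snd z))\<^sup>2)"
    using assms by (simp add: norm_prod_def flip: distrib_left) (simp add: real_sqrt_mult)
  ultimately show "q * norm z \<le> norm (diag p q z)" "q * norm z \<le> norm (diag q p z)"
    by (simp_all add: norm_diag add_mono)
qed

text \<open>For \<open>q \<le> 1/2\<close> one has \<open>q\<^sup>2 \<le> 1 - q\<^sup>2\<close>, so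
  the weight \<open>p = sqrt (1 - q\<^sup>2)\<close> dominates \<open>q\<close>. The estimates that
  follow know \<open>p\<close> only through these facts.\<close>

lemma pair_norm_cases:
  assumes "0 < q" "q \<le> 1/2"
  obtains p where "q \<le> p" "0 < p" "p \<le> 1" "p\<^sup>2 + q\<^sup>2 = 1"
    and "\<And>z. pair_norm q z = norm (diag p q z) + norm (diag q p z)"
proof -
  have "q\<^sup>2 \<le> (1/2)\<^sup>2" using assms by (intro power_mono) auto
  then have *: "q\<^sup>2 \<le> 1/4" by (simp add: power2_eq_square)
  then have "q \<le> sqrt (1 - q\<^sup>2)" by (intro real_le_rsqrt) simp
  then show ?thesis
    using * assms by (intro that[of "sqrt (1 - q\<^sup>2)"]) (auto simp: pair_norm_def)
qed

text \<open>The two Hilbert norms carry swapped weights, so adding their lower bounds from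
  \<open>norm_diag_ge\<close> gives each coordinate the coefficient
  \<open>p\<^sup>2 + q\<^sup>2 = 1\<close>.\<close>

lemma pair_norm_ge:
  assumes "0 < q" "q \<le> 1/2"
  shows "cmod (fst z) + cmod (snd z) \<le> pair_norm q z"
proof -
  obtain p where p: "p\<^sup>2 + q\<^sup>2 = 1"
    and N: "\<And>z. pair_norm q z = norm (diag p q z) + norm (diag q p z)"
    using pair_norm_cases[OF assms] by blast
  have "cmod (fst z) + cmod (snd z) = (p\<^sup>2 + q\<^sup>2) * cmod (fst z) + (p\<^sup>2 + q\<^sup>2) * cmod (snd z)"
    using p by simp
  also have "\<dots> \<le> pair_norm q z"
    using norm_diag_ge[of p q z] norm_diag_ge[of q p z] p
    unfolding N distrib_right by linarith
  finally show ?thesis .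
qed

text \<open>The triangle inequality in both Hilbert norms gives each coordinate the total weight
  \<open>p + q\<close>, and \<open>p \<le> 1\<close>.\<close>

lemma pair_norm_le:
  assumes "0 < q" "q \<le> 1/2"
  shows "pair_norm q z \<le> (1 + q) * (cmod (fst z) + cmod (snd z))"
proof -
  obtain p where p: "0 < p" "p \<le> 1"
    and N: "\<And>z. pair_norm q z = norm (diag p q z) + norm (diag q p z)"
    using pair_norm_cases[OF assms] by blast
  have "pair_norm q z \<le> (p + q) * (cmod (fst z) + cmod (snd z))"
    using norm_diag_le[of p q z] norm_diag_le[of q p z] p assms
    unfolding N by (simp add: algebra_simps)
  also have "\<dots> \<le> (1 + q) * (cmod (fst z) + cmod (snd z))"
    using p by (intro mult_right_mono) auto
  finally show ?thesis .
qed

lemma pair_norm_triangle: "pair_norm q (x + y) \<le> pair_norm q x + pair_norm q y"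
  unfolding pair_norm_def diag_add
  using norm_triangle_ineq[of "diag q (sqrt (1 - q\<^sup>2)) x" "diag q (sqrt (1 - q\<^sup>2)) y"]
    norm_triangle_ineq[of "diag (sqrt (1 - q\<^sup>2)) q x" "diag (sqrt (1 - q\<^sup>2)) q y"]
  by linarith

lemma norm_diag_scale: "norm (diag p q (k * fst z, k * snd z)) = cmod k * norm (diag p q z)"
proof -
  have "p\<^sup>2 * (cmod (k * fst z))\<^sup>2 + q\<^sup>2 * (cmod (k * snd z))\<^sup>2
      = (cmod k)\<^sup>2 * (p\<^sup>2 * (cmod (fst z))\<^sup>2 + q\<^sup>2 * (cmod (snd z))\<^sup>2)"
    by (simp add: norm_mult power_mult_distrib algebra_simps)
  then show ?thesis by (simp add: norm_diag real_sqrt_mult)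
qed

lemma pair_norm_scale: "pair_norm q (k * fst z, k * snd z) = cmod k * pair_norm q z"
  unfolding pair_norm_def norm_diag_scale by (simp add: distrib_left)

text \<open>When the coordinates have equal modulus, each Hilbert norm equals that modulus. Exact
  values such as 2 for \<open>(1, - 1)\<close> and 1 for \<open>(1/2, 1/2)\<close> come from
  here.\<close>

lemma pair_norm_diagonal:
  assumes "0 < q" "q \<le> 1/2" "cmod a = cmod b"
  shows "pair_norm q (a, b) = cmod a + cmod b"
proof -
  obtain p where p: "p\<^sup>2 + q\<^sup>2 = 1"
    and N: "\<And>z. pair_norm q z = norm (diag p q z) + norm (diag q p z)"
    using pair_norm_cases[OF assms(1,2)] by blast
  show ?thesis
    using p assms(3) by (simp add: N norm_diag add.commute flip: distrib_right)
qed

text \<open>Each Hilbert norm has a quadratic excess divided by its own value at \<open>x\<close>.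
  On the unit sphere of \<open>pair_norm q\<close> these values are at least \<open>q / 4\<close>,
  which makes the estimate uniform.\<close>

lemma pair_norm_smooth:
  assumes q: "0 < q" "q \<le> 1/2" and x: "pair_norm q x = 1" and y: "pair_norm q y \<le> t"
  shows "(pair_norm q (x + y) + pair_norm q (x - y) - 2) / 2 \<le> 4 / q * t\<^sup>2"
proof -
  obtain p where p: "q \<le> p" "0 < p" "p \<le> 1"
    and N: "\<And>z. pair_norm q z = norm (diag p q z) + norm (diag q p z)"
    using pair_norm_cases[OF q] by blast
  have "cmod (fst x) \<le> norm x" "cmod (snd x) \<le> norm x"
    by (metis norm_fst_le prod.collapse, metis norm_snd_le prod.collapse)
  \<comment> \<open>Each weight is at most 1, so each Hilbert norm of \<open>x\<close> is at most
    \<open>2 * norm x\<close>, while the two add up to 1.\<close>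
  then have "norm (diag p q x) \<le> p * norm x + q * norm x"
    "norm (diag q p x) \<le> p * norm x + q * norm x"
    using norm_diag_le[of p q x] norm_diag_le[of q p x] p q
    by (smt (verit) mult_left_mono)+
  moreover have "p * norm x \<le> 1 * norm x" "q * norm x \<le> 1 * norm x"
    using p q by (intro mult_right_mono; simp)+
  ultimately have nx: "1/4 \<le> norm x" using x by (simp add: N)
  \<comment> \<open>Here \<open>u\<close> and \<open>v\<close> stand for the images of
    \<open>x\<close> and \<open>y\<close> under either diagonal map; \<open>4 / q\<close> is the
    reciprocal of the lower bound \<open>q / 4\<close> for \<open>norm u\<close>.\<close>
  have *: "norm (u + v) + norm (u - v) \<le> 2 * norm u + 4 / q * t\<^sup>2"
    if u: "q * norm x \<le> norm u" and v: "norm v \<le> t" for u v :: "complex \<times> complex"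
  proof -
    have "q * (1/4) \<le> q * norm x" using nx q by (intro mult_left_mono) auto
    then have u': "q / 4 \<le> norm u" using u by simp
    then have "u \<noteq> 0" using q by auto
    then have "norm (u + v) + norm (u - v) \<le> 2 * norm u + (norm v)\<^sup>2 / norm u"
      by (rule norm_add_diff_le)
    also have "(norm v)\<^sup>2 / norm u \<le> t\<^sup>2 / (q / 4)"
      using u' v q by (intro frac_le power_mono) auto
    finally show ?thesis by (simp add: mult.commute)
  qed
  have "norm (diag p q y) \<le> t" "norm (diag q p y) \<le> t"
    using y norm_ge_zero[of "diag q p y"] norm_ge_zero[of "diag p q y"]
    unfolding N by linarith+
  then have "pair_norm q (x + y) + pair_norm q (x - y) \<le> 2 * pair_norm q x + 8 / q * t\<^sup>2"
    using *[OF norm_diag_ge_min(1)[OF _ p(1)], of "diag p q y"]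
      *[OF norm_diag_ge_min(2)[OF _ p(1)], of "diag q p y"] q
    by (simp add: N diag_add diag_diff)
  then show ?thesis using x by simp
qed

section \<open>The plane as a carrier-based Banach space\<close>

text \<open>The injection \<open>\<phi>\<close> places the plane inside the given type.\<close>

definition pair_space ::
    "(complex \<times> complex \<Rightarrow> 'u) \<Rightarrow> complex set \<Rightarrow> (complex \<times> complex \<Rightarrow> real) \<Rightarrow> 'u normed_module" where
  "pair_space \<phi> K \<nu> = \<lparr>carrier = \<phi> ` (K \<times> K), mult = undefined, one = undefined, zero = \<phi> 0,
     add = (\<lambda>x y. \<phi> (inv_into UNIV \<phi> x + inv_into UNIV \<phi> y)),
     smult = (\<lambda>k x. \<phi> (k * fst (inv_into UNIV \<phi> x), k * snd (inv_into UNIV \<phi> x))),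
     nrm = (\<lambda>x. \<nu> (inv_into UNIV \<phi> x))\<rparr>"

text \<open>The bounds \<open>lower\<close> and \<open>upper\<close> express equivalence with the
  Euclidean norm and yield definiteness and completeness. In the application, \<open>cring\<close>
  is inherited from the module \<open>Y\<close>.\<close>

locale normed_pairs =
  fixes \<phi> :: "complex \<times> complex \<Rightarrow> 'u" and K :: "complex set"
    and \<nu> :: "complex \<times> complex \<Rightarrow> real" and C :: real
  assumes inj: "inj \<phi>" and K: "K = \<real> \<or> K = UNIV" and cring: "cring (scalars K)"
    and scale: "\<nu> (k * fst z, k * snd z) = cmod k * \<nu> z"
    and triangle: "\<nu> (z + w) \<le> \<nu> z + \<nu> w"
    and lower: "norm z \<le> \<nu> z" and upper: "\<nu> z \<le> C * norm z"
begin

abbreviation X :: "'u normed_module" where "X \<equiv> pair_space \<phi> K \<nu>"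

lemma X_simps [simp]:
  "carrier X = \<phi> ` (K \<times> K)" "\<zero>\<^bsub>X\<^esub> = \<phi> 0" "\<phi> z \<oplus>\<^bsub>X\<^esub> \<phi> w = \<phi> (z + w)"
  "k \<odot>\<^bsub>X\<^esub> \<phi> z = \<phi> (k * fst z, k * snd z)" "nrm X (\<phi> z) = \<nu> z"
  using inj by (simp_all add: pair_space_def)

lemma phi_eq [simp]: "\<phi> z = \<phi> w \<longleftrightarrow> z = w"
  using inj by (simp add: inj_eq)

lemma phi_mem [simp]: "\<phi> z \<in> \<phi> ` A \<longleftrightarrow> z \<in> A"
  using inj by (rule inj_image_mem_iff)

lemma K_closed [simp]:
  "of_real r \<in> K" "0 \<in> K" "1 \<in> K"
  "a \<in> K \<Longrightarrow> b \<in> K \<Longrightarrow> a + b \<in> K" "a \<in> K \<Longrightarrow> b \<in> K \<Longrightarrow> a - b \<in> K"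
  "a \<in> K \<Longrightarrow> b \<in> K \<Longrightarrow> a * b \<in> K" "a \<in> K \<Longrightarrow> - a \<in> K"
  using real_closed_subfield[OF K] real_closed_subfield(1)[OF K, of 0]
    real_closed_subfield(1)[OF K, of 1] by auto

lemma zero_mem [simp]: "0 \<in> K \<times> K"
  by (simp add: zero_prod_def)

lemma carrierE:
  assumes "x \<in> carrier X"
  obtains z where "x = \<phi> z" "z \<in> K \<times> K"
  using assms by auto

lemma abelian_group: "abelian_group X"
proof (rule abelian_groupI)
  fix x assume "x \<in> carrier X"
  then obtain z where z: "x = \<phi> z" "z \<in> K \<times> K" by (rule carrierE)
  then have "\<phi> (- z) \<in> carrier X" by auto
  moreover have "\<phi> (- z) \<oplus>\<^bsub>X\<^esub> x = \<zero>\<^bsub>X\<^esub>" using z by simp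
  ultimately show "\<exists>y\<in>carrier X. y \<oplus>\<^bsub>X\<^esub> x = \<zero>\<^bsub>X\<^esub>" by blast
qed (auto simp: add_ac)

lemma module: "Module.module (scalars K) X"
  by (rule moduleI[OF cring abelian_group]) (auto simp: scalars_def algebra_simps)

lemma minus [simp]:
  assumes "z \<in> K \<times> K" "w \<in> K \<times> K"
  shows "\<phi> z \<ominus>\<^bsub>X\<^esub> \<phi> w = \<phi> (z - w)"
proof -
  have "\<ominus>\<^bsub>X\<^esub> \<phi> w = \<phi> (- w)"
    using assms by (intro abelian_group.minus_equality[OF abelian_group]) auto
  then show ?thesis by (simp add: a_minus_def)
qed

lemma nu_zero [simp]: "\<nu> z = 0 \<longleftrightarrow> z = 0"
  using lower[of z] upper[of z] by auto

lemma nu_nonneg [simp]: "0 \<le> \<nu> z"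
  using lower[of z] norm_ge_zero[of z] by linarith

lemma nu_minus: "\<nu> (z - w) = \<nu> (w - z)"
  using scale[of "-1" "z - w"] by (simp add: minus_prod_def prod_eq_iff)

lemma normed_space: "normed_space K X"
  by (intro normed_space.intro normed_space_axioms.intro module)
    (auto intro: scale[where z = "(a, b)" for a b, simplified] triangle[where z = "(a, b)" and w = "(c, d)" for a b c d, simplified])

lemma nrm_dist:
  "z \<in> K \<times> K \<Longrightarrow> w \<in> K \<times> K \<Longrightarrow> nrm_dist X (\<phi> z) (\<phi> w) = \<nu> (z - w)"
  by (simp add: nrm_dist_def)

lemma Metric_space: "Metric_space (carrier X) (nrm_dist X)"
proof
  fix x y
  show "0 \<le> nrm_dist X x y"
    by (auto simp: nrm_dist_def elim!: carrierE simp del: X_simps(1))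
  show "nrm_dist X x y = nrm_dist X y x"
    using nu_minus[of "(a, b)" "(c, d)" for a b c d]
    by (auto simp: nrm_dist_def elim!: carrierE simp del: X_simps(1))
  show "nrm_dist X x y = 0 \<longleftrightarrow> x = y" if "x \<in> carrier X" "y \<in> carrier X"
    using that by (auto simp: nrm_dist zero_prod_def elim!: carrierE simp del: X_simps(1))
  show "nrm_dist X x z \<le> nrm_dist X x y + nrm_dist X y z"
    if xyz: "x \<in> carrier X" "y \<in> carrier X" "z \<in> carrier X" for z
  proof -
    obtain a where "x = \<phi> a" "a \<in> K \<times> K" using xyz(1) by (rule carrierE)
    moreover obtain b where "y = \<phi> b" "b \<in> K \<times> K" using xyz(2) by (rule carrierE)
    moreover obtain c where "z = \<phi> c" "c \<in> K \<times> K" using xyz(3) by (rule carrierE)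
    ultimately show ?thesis using triangle[of "a - b" "b - c"] by (simp add: nrm_dist)
  qed
qed

text \<open>Completeness is transferred from the Euclidean plane: \<open>lower\<close> carries the
  Cauchy property over, the limit stays in the closed set \<open>K \<times> K\<close>, and
  \<open>upper\<close> carries convergence back.\<close>

lemma banach_space: "banach_space K X"
proof (intro banach_space.intro banach_space_axioms.intro normed_space)
  interpret Metric_space "carrier X" "nrm_dist X" by (rule Metric_space)
  show "Metric_space.mcomplete (carrier X) (nrm_dist X)"
    unfolding mcomplete_def
  proof (intro allI impI)
    fix s assume s: "MCauchy s"
    then have s_mem: "s n \<in> carrier X" for n by (auto simp only: MCauchy_def)
    have "\<exists>z. z \<in> K \<times> K \<and> s n = \<phi> z" for n
      by (rule carrierE[OF s_mem[of n]]) blast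
    then obtain u where u: "\<And>n. u n \<in> K \<times> K" "\<And>n. s n = \<phi> (u n)" by metis
    have "Cauchy u"
    proof (rule metric_CauchyI)
      fix e :: real assume "0 < e"
      then obtain N where "\<forall>n n'. N \<le> n \<longrightarrow> N \<le> n' \<longrightarrow> \<nu> (u n - u n') < e"
        using s unfolding MCauchy_def u(2) nrm_dist[OF u(1) u(1)] by blast
      then show "\<exists>M. \<forall>m\<ge>M. \<forall>n\<ge>M. dist (u m) (u n) < e"
        using lower by (metis dist_norm le_less_trans)
    qed
    then obtain l where l: "u \<longlonglongrightarrow> l" using Cauchy_convergent_iff convergent_def by blast
    have "closed (K \<times> K)" using real_closed_subfield(2)[OF K] by (intro closed_Times)
    then have lK: "l \<in> K \<times> K" using l u(1) closed_sequentially by blast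
    have "(\<lambda>n. \<nu> (u n - l)) \<longlonglongrightarrow> 0"
    proof (rule Lim_null_comparison)
      show "\<forall>\<^sub>F n in sequentially. norm (\<nu> (u n - l)) \<le> C * norm (u n - l)"
        using upper by simp
      show "(\<lambda>n. C * norm (u n - l)) \<longlonglongrightarrow> 0"
        using l by (intro tendsto_mult_right_zero) (simp add: LIM_zero tendsto_norm_zero)
    qed
    then have "limitin mtopology s (\<phi> l) sequentially"
      unfolding limitin_metric_dist_null u(2) nrm_dist[OF u(1) lK]
      using u(1) lK by (auto)
    then show "\<exists>x. limitin mtopology s x sequentially" ..
  qed
qed

end

section \<open>Uniform smoothness of the plane\<close>

lemma pair_space_uniformly_smooth:
  assumes "normed_pairs \<phi> K (pair_norm q) C" and q: "0 < q" "q \<le> 1/2"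
  shows "uniformly_smooth (pair_space \<phi> K (pair_norm q))"
proof -
  interpret normed_pairs \<phi> K "pair_norm q" C by fact
  have bounds: "0 \<le> modulus_of_smoothness X t \<and> modulus_of_smoothness X t \<le> 4 / q * t\<^sup>2"
    if "0 < t" for t
  proof -
    let ?A = "{(nrm X (x \<oplus>\<^bsub>X\<^esub> y) + nrm X (x \<ominus>\<^bsub>X\<^esub> y) - 2) / 2 | x y.
       x \<in> carrier X \<and> y \<in> carrier X \<and> nrm X x = 1 \<and> nrm X y \<le> t}"
    have le: "a \<le> 4 / q * t\<^sup>2" if "a \<in> ?A" for a
    proof -
      obtain z w where z: "a = (pair_norm q (z + w) + pair_norm q (z - w) - 2) / 2"
        "pair_norm q z = 1" "pair_norm q w \<le> t"
        using \<open>a \<in> ?A\<close> by (force elim!: carrierE simp del: X_simps(1))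
      then show ?thesis using pair_norm_smooth[OF q z(2,3)] by simp
    qed
    \<comment> \<open>The unit vector \<open>(1/2, 1/2)\<close> with \<open>y = 0\<close>
      contributes the value 0, so the set is nonempty and its supremum is nonnegative.\<close>
    have "(of_real (1/2), of_real (1/2)) \<in> K \<times> K"
      using real_closed_subfield(1)[OF K] by blast
    moreover have "pair_norm q (of_real (1/2), of_real (1/2)) = 1"
      by (subst pair_norm_diagonal[OF q]) auto
    ultimately have 0: "0 \<in> ?A"
      by - (rule CollectI, rule exI[of _ "\<phi> (of_real (1/2), of_real (1/2))"],
          rule exI[of _ "\<phi> 0"], use \<open>0 < t\<close> nu_zero[of 0] in \<open>simp del: of_real_divide nu_zero\<close>)
    have "0 \<le> Sup ?A" by (rule cSup_upper[OF 0 bdd_aboveI[OF le]])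
    moreover have "Sup ?A \<le> 4 / q * t\<^sup>2" using 0 by (intro cSup_least[OF _ le]) blast
    ultimately show ?thesis unfolding modulus_of_smoothness_def by blast
  qed
  show ?thesis
    unfolding uniformly_smooth_def
  proof (rule Lim_null_comparison)
    show "\<forall>\<^sub>F t in at_right 0. norm (modulus_of_smoothness X t / t) \<le> 4 / q * t"
      using bounds q by (intro eventually_at_rightI[of 0 1])
        (auto simp: field_simps power2_eq_square)
    show "((\<lambda>t. 4 / q * t) \<longlongrightarrow> 0) (at_right 0)"
      by (intro tendsto_mult_right_zero tendsto_ident_at)
  qed
qed

section \<open>Operator norm estimates\<close>

context normed_space
begin

lemma scalars_simps [simp]:
  "carrier (scalars K) = K" "\<one>\<^bsub>scalars K\<^esub> = 1" "\<zero>\<^bsub>scalars K\<^esub> = 0"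
  "a \<oplus>\<^bsub>scalars K\<^esub> b = a + b" "a \<otimes>\<^bsub>scalars K\<^esub> b = a * b"
  by (simp_all add: scalars_def)

text \<open>Homogeneity for the scalar -1, once the inverse of 1 in the ring
  \<open>scalars K\<close> is identified with the complex number -1.\<close>

lemma nrm_uminus:
  assumes "x \<in> carrier X"
  shows "nrm X (\<ominus>\<^bsub>X\<^esub> x) = nrm X x"
proof -
  have 1: "1 \<in> K" using R.one_closed by simp
  then have m: "\<ominus>\<^bsub>scalars K\<^esub> 1 \<in> K" using R.a_inv_closed[of 1] by simp
  have "\<ominus>\<^bsub>scalars K\<^esub> 1 + 1 = 0" using R.l_neg[of 1] 1 by simp
  then have "\<ominus>\<^bsub>scalars K\<^esub> 1 = - 1" by (simp add: eq_neg_iff_add_eq_0)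
  then have "\<ominus>\<^bsub>X\<^esub> x = (- 1) \<odot>\<^bsub>X\<^esub> x" "- 1 \<in> K"
    using smult_l_minus[of 1 x] 1 m assms smult_one[OF assms] by auto
  then show ?thesis using assms by (simp add: nrm_smult)
qed

lemma nrm_minus_le:
  "x \<in> carrier X \<Longrightarrow> y \<in> carrier X \<Longrightarrow> nrm X (x \<ominus>\<^bsub>X\<^esub> y) \<le> nrm X x + nrm X y"
  using nrm_triangle[of x "\<ominus>\<^bsub>X\<^esub> y"] by (simp add: a_minus_def nrm_uminus)

lemma smult_minus:
  "k \<in> K \<Longrightarrow> x \<in> carrier X \<Longrightarrow> y \<in> carrier X \<Longrightarrow>
    k \<odot>\<^bsub>X\<^esub> (x \<ominus>\<^bsub>X\<^esub> y) = k \<odot>\<^bsub>X\<^esub> x \<ominus>\<^bsub>X\<^esub> k \<odot>\<^bsub>X\<^esub> y"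
  by (simp add: a_minus_def smult_r_distr smult_r_minus)

text \<open>Formulated for maps \<open>F\<close> whose norm is homogeneous and bounded, so that it
  covers both an operator and a difference \<open>op_diff\<close>. Boundedness makes the supremum in
  \<open>op_norm\<close> meaningful.\<close>

lemma nrm_le_op_norm:
  assumes reals: "\<And>r. of_real r \<in> K"
    and homogeneous: "\<And>k x. k \<in> K \<Longrightarrow> x \<in> carrier X \<Longrightarrow> nrm Y (F (k \<odot>\<^bsub>X\<^esub> x)) = cmod k * nrm Y (F x)"
    and bound: "\<And>x. x \<in> carrier X \<Longrightarrow> nrm Y (F x) \<le> C * nrm X x"
    and x: "x \<in> carrier X"
  shows "nrm Y (F x) \<le> op_norm X Y F * nrm X x"
proof (cases "nrm X x = 0")
  case True
  then show ?thesis using bound[OF x] by simp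
next
  case False
  then have pos: "0 < nrm X x" using nrm_nonneg[OF x] by simp
  define k where "k = complex_of_real (1 / nrm X x)"
  have k: "k \<in> K" "cmod k = 1 / nrm X x"
    using reals pos unfolding k_def by (simp_all add: norm_divide del: of_real_divide)
  have bdd: "bdd_above ((\<lambda>x. nrm Y (F x)) ` {x \<in> carrier X. nrm X x \<le> 1})"
  proof (rule bdd_aboveI2)
    fix z assume z: "z \<in> {x \<in> carrier X. nrm X x \<le> 1}"
    \<comment> \<open>The sign of \<open>C\<close> is unknown, hence the absolute value.\<close>
    have "C * nrm X z \<le> \<bar>C\<bar> * nrm X z"
      using z nrm_nonneg[of z] by (intro mult_right_mono) auto
    also have "\<dots> \<le> \<bar>C\<bar> * 1" using z by (intro mult_left_mono) auto
    finally show "nrm Y (F z) \<le> \<bar>C\<bar>" using bound[of z] z by simp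
  qed
  have "nrm Y (F (k \<odot>\<^bsub>X\<^esub> x)) \<le> op_norm X Y F"
    unfolding op_norm_def
    by (rule cSUP_upper[OF _ bdd]) (use k x pos in \<open>auto simp: nrm_smult\<close>)
  then show ?thesis
    using pos by (simp add: homogeneous k x field_simps)
qed

end

lemma nrm_apply_le_op_norm:
  assumes "normed_space K X" "normed_space K Y" and reals: "\<And>r. of_real r \<in> K"
    and S: "S \<in> bounded_operators K X Y" and x: "x \<in> carrier X"
  shows "nrm Y (S x) \<le> op_norm X Y S * nrm X x"
proof -
  interpret X: normed_space K X by fact
  interpret Y: normed_space K Y by fact
  have S': "S z \<in> carrier Y" "k \<in> K \<Longrightarrow> S (k \<odot>\<^bsub>X\<^esub> z) = k \<odot>\<^bsub>Y\<^esub> S z"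
    if "z \<in> carrier X" for z k
    using that S by (auto simp: bounded_operators_def)
  obtain C where "\<And>x. x \<in> carrier X \<Longrightarrow> nrm Y (S x) \<le> C * nrm X x"
    using S unfolding bounded_operators_def by blast
  then show ?thesis
    using S' x reals by (intro X.nrm_le_op_norm[where C = C]) (auto simp: Y.nrm_smult)
qed

lemma nrm_diff_le_op_norm:
  assumes "normed_space K X" "normed_space K Y" and reals: "\<And>r. of_real r \<in> K"
    and S: "S \<in> bounded_operators K X Y" and T: "T \<in> bounded_operators K X Y"
    and x: "x \<in> carrier X"
  shows "nrm Y (S x \<ominus>\<^bsub>Y\<^esub> T x) \<le> op_norm X Y (op_diff X Y S T) * nrm X x"
proof -
  interpret X: normed_space K X by fact
  interpret Y: normed_space K Y by fact
  have S': "S z \<in> carrier Y" "k \<in> K \<Longrightarrow> S (k \<odot>\<^bsub>X\<^esub> z) = k \<odot>\<^bsub>Y\<^esub> S z"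
    and T': "T z \<in> carrier Y" "k \<in> K \<Longrightarrow> T (k \<odot>\<^bsub>X\<^esub> z) = k \<odot>\<^bsub>Y\<^esub> T z"
    if "z \<in> carrier X" for z k
    using that S T by (auto simp: bounded_operators_def)
  obtain C where C: "\<And>x. x \<in> carrier X \<Longrightarrow> nrm Y (S x) \<le> C * nrm X x"
    using S unfolding bounded_operators_def by blast
  obtain D where D: "\<And>x. x \<in> carrier X \<Longrightarrow> nrm Y (T x) \<le> D * nrm X x"
    using T unfolding bounded_operators_def by blast
  have "nrm Y (op_diff X Y S T x) \<le> op_norm X Y (op_diff X Y S T) * nrm X x"
  proof (rule X.nrm_le_op_norm[OF reals _ _ x])
    fix z assume z: "z \<in> carrier X"
    show "nrm Y (op_diff X Y S T (k \<odot>\<^bsub>X\<^esub> z)) = cmod k * nrm Y (op_diff X Y S T z)" if "k \<in> K" for k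
      using that z S' T' by (simp add: op_diff_def Y.nrm_smult flip: Y.smult_minus)
    show "nrm Y (op_diff X Y S T z) \<le> (C + D) * nrm X z"
      using Y.nrm_minus_le[of "S z" "T z"] S' T' C[OF z] D[OF z] z
      by (simp add: op_diff_def algebra_simps)
  qed
  then show ?thesis using x by (simp add: op_diff_def)
qed

section \<open>An operator that cannot be corrected at a point\<close>

text \<open>Replacing the \<open>\<ell>\<^sub>1\<close> norm by \<open>pair_norm q\<close> costs at
  most \<open>q\<close>, whereas closeness of \<open>S\<close> to \<open>T\<close> gains
  \<open>2 * (r * (1 - \<epsilon>))\<close>; the hypothesis
  \<open>q \<le> r * (1 - \<epsilon>)\<close> lets the gain absorb the cost.\<close>

lemma nrm_apply_less:
  assumes "normed_pairs \<phi> K (pair_norm q) C" and "normed_space K Y"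
    and q: "0 < q" "q \<le> 1/2" and r: "0 < r" "r \<le> 1" "q \<le> r * (1 - \<epsilon>)"
    and S: "S \<in> bounded_operators K (pair_space \<phi> K (pair_norm q)) Y"
    and T: "T \<in> bounded_operators K (pair_space \<phi> K (pair_norm q)) Y"
    and S1: "op_norm (pair_space \<phi> K (pair_norm q)) Y S \<le> 1"
    and ST: "op_norm (pair_space \<phi> K (pair_norm q)) Y (op_diff (pair_space \<phi> K (pair_norm q)) Y S T) < \<epsilon>"
    and Tw: "T (\<phi> (1, - 1)) = \<zero>\<^bsub>Y\<^esub>"
  shows "nrm Y (S (\<phi> (1, - of_real r))) < 1 + r"
proof -
  interpret normed_pairs \<phi> K "pair_norm q" C by fact
  interpret Y: normed_space K Y by fact
  let ?w = "\<phi> (1, - 1)" and ?e = "\<phi> (1, 0)"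
  have we: "?w \<in> carrier X" "?e \<in> carrier X" by auto
  have Sc: "\<And>x. x \<in> carrier X \<Longrightarrow> S x \<in> carrier Y"
    and Sadd: "\<And>x y. x \<in> carrier X \<Longrightarrow> y \<in> carrier X \<Longrightarrow> S (x \<oplus>\<^bsub>X\<^esub> y) = S x \<oplus>\<^bsub>Y\<^esub> S y"
    and Ssm: "\<And>k x. k \<in> K \<Longrightarrow> x \<in> carrier X \<Longrightarrow> S (k \<odot>\<^bsub>X\<^esub> x) = k \<odot>\<^bsub>Y\<^esub> S x"
    using S by (auto simp: bounded_operators_def)
  have smc: "\<And>k x. k \<in> K \<Longrightarrow> x \<in> carrier X \<Longrightarrow> k \<odot>\<^bsub>X\<^esub> x \<in> carrier X"
    using module.smult_closed[OF module] by (simp add: scalars_def)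
  have "\<phi> (1, - of_real r) = of_real r \<odot>\<^bsub>X\<^esub> ?w \<oplus>\<^bsub>X\<^esub> of_real (1 - r) \<odot>\<^bsub>X\<^esub> ?e"
    by simp
  then have "S (\<phi> (1, - of_real r)) = of_real r \<odot>\<^bsub>Y\<^esub> S ?w \<oplus>\<^bsub>Y\<^esub> of_real (1 - r) \<odot>\<^bsub>Y\<^esub> S ?e"
    using Sadd[OF smc smc] Ssm we K_closed(1) by presburger
  then have "nrm Y (S (\<phi> (1, - of_real r)))
      \<le> nrm Y (of_real r \<odot>\<^bsub>Y\<^esub> S ?w) + nrm Y (of_real (1 - r) \<odot>\<^bsub>Y\<^esub> S ?e)"
    using Sc we Y.nrm_triangle[OF Y.smult_closed Y.smult_closed] by simp
  also have "\<dots> = r * nrm Y (S ?w) + (1 - r) * nrm Y (S ?e)"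
    using r Y.nrm_smult[OF K_closed(1) Sc] we by (simp del: of_real_diff X_simps)
  also have "\<dots> < r * (2 * \<epsilon>) + (1 - r) * (1 + q)"
  proof (rule add_less_le_mono)
    \<comment> \<open>\<open>T\<close> vanishes at \<open>?w\<close>, so \<open>S ?w\<close> is the
      value of the difference of \<open>S\<close> and \<open>T\<close>. The strict inequality of the
      whole chain originates here.\<close>
    have "nrm Y (S ?w) \<le> op_norm X Y (op_diff X Y S T) * nrm X ?w"
      using nrm_diff_le_op_norm[OF normed_space assms(2) K_closed(1) S T we(1)] Sc[OF we(1)]
      by (simp add: Tw a_minus_def Y.M.minus_equality[of "\<zero>\<^bsub>Y\<^esub>" "\<zero>\<^bsub>Y\<^esub>"])
    moreover have "nrm X ?w = 2" using pair_norm_diagonal[OF q, of 1 "- 1"] by simp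
    ultimately show "r * nrm Y (S ?w) < r * (2 * \<epsilon>)" using ST r by simp
    have "nrm X ?e \<le> 1 + q" using pair_norm_le[OF q, of "(1, 0)"] by simp
    moreover have "nrm Y (S ?e) \<le> op_norm X Y S * nrm X ?e"
      by (rule nrm_apply_le_op_norm[OF normed_space assms(2) K_closed(1) S we(2)])
    moreover have "op_norm X Y S * nrm X ?e \<le> 1 * nrm X ?e"
      using S1 by (intro mult_right_mono) auto
    ultimately show "(1 - r) * nrm Y (S ?e) \<le> (1 - r) * (1 + q)"
      using r by (intro mult_left_mono) auto
  qed
  also have "\<dots> = 1 + r + (1 - r) * q - 2 * (r * (1 - \<epsilon>))" by (simp add: algebra_simps)
  also have "\<dots> \<le> 1 + r"
  proof -
    have "(1 - r) * q \<le> 1 * q" using q r by (intro mult_right_mono) auto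
    then show ?thesis using r(3) q by linarith
  qed
  finally show ?thesis .
qed

text \<open>One operator \<open>T\<close> and one point \<open>x\<^sub>0\<close> suffice:
  \<open>T x\<^sub>0\<close> has norm above \<open>1 - \<delta>\<close>, but no admissible
  \<open>S\<close> attains its norm at \<open>x\<^sub>0\<close>. Every \<open>\<rho>\<close> in the
  supremum is therefore below \<open>\<delta>\<close>.\<close>

lemma pair_space_modulus_le:
  fixes Y :: "'y normed_module" and \<phi> :: "complex \<times> complex \<Rightarrow> 'u"
  assumes pairs: "normed_pairs \<phi> K (pair_norm q) C" and Y: "normed_space K Y"
    and nz: "carrier Y \<noteq> {\<zero>\<^bsub>Y\<^esub>}"
    and q: "0 < q" "q \<le> 1/2" and r: "0 < r" "3 * r < \<delta>" "r < 1" "q \<le> r * (1 - \<epsilon>)" "q \<le> r"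
  shows "pointwise_BPB_modulus K (pair_space \<phi> K (pair_norm q)) Y \<epsilon> \<le> ennreal \<delta>"
proof -
  interpret normed_pairs \<phi> K "pair_norm q" C by fact
  interpret Y: normed_space K Y by fact
  obtain y where y: "y \<in> carrier Y" "y \<noteq> \<zero>\<^bsub>Y\<^esub>" using nz Y.M.zero_closed by blast
  then have ny: "0 < nrm Y y" using Y.nrm_nonneg[of y] Y.nrm_eq_0_iff[of y] by linarith
  define y\<^sub>0 where "y\<^sub>0 = of_real (1 / nrm Y y) \<odot>\<^bsub>Y\<^esub> y"
  have y0: "y\<^sub>0 \<in> carrier Y" "nrm Y y\<^sub>0 = 1"
    using y(1) ny K_closed(1) unfolding y\<^sub>0_def
    by (simp_all add: Y.nrm_smult norm_divide del: of_real_divide)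
  define T where "T = (\<lambda>x\<in>carrier X. (fst (inv_into UNIV \<phi> x) + snd (inv_into UNIV \<phi> x)) \<odot>\<^bsub>Y\<^esub> y\<^sub>0)"
  have T_phi: "T (\<phi> (a, b)) = (a + b) \<odot>\<^bsub>Y\<^esub> y\<^sub>0" if "a \<in> K" "b \<in> K" for a b
    using that inj by (simp add: T_def)
  have nrm_T: "nrm Y (T (\<phi> (a, b))) = cmod (a + b)" if "a \<in> K" "b \<in> K" for a b
    using that y0 by (simp add: T_phi Y.nrm_smult)
  have T_le: "nrm Y (T x) \<le> nrm X x" if "x \<in> carrier X" for x
    using that
  proof (rule carrierE)
    fix z assume z: "x = \<phi> z" "z \<in> K \<times> K"
    then show ?thesis
      using nrm_T[of "fst z" "snd z"] norm_triangle_ineq[of "fst z" "snd z"] pair_norm_ge[OF q, of z]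
      by (simp add: mem_Times_iff)
  qed
  have T_bounded: "T \<in> bounded_operators K X Y"
    unfolding bounded_operators_def
  proof (intro CollectI conjI ballI exI[of _ 1])
    show "T \<in> carrier X \<rightarrow>\<^sub>E carrier Y"
      using y0 by (auto simp: T_def inj)
    show "nrm Y (T x) \<le> 1 * nrm X x" if "x \<in> carrier X" for x using T_le[OF that] by simp
    show "T (x \<oplus>\<^bsub>X\<^esub> y) = T x \<oplus>\<^bsub>Y\<^esub> T y" if xy: "x \<in> carrier X" "y \<in> carrier X" for x y
    proof -
      obtain a b c d where "x = \<phi> (a, b)" "y = \<phi> (c, d)" and K: "a \<in> K" "b \<in> K" "c \<in> K" "d \<in> K"
        using xy by auto
      then show ?thesis
        using Y.smult_l_distr[of "a + b" "c + d" y\<^sub>0] y0 by (simp add: T_phi add_ac)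
    qed
    show "T (k \<odot>\<^bsub>X\<^esub> x) = k \<odot>\<^bsub>Y\<^esub> T x" if k: "k \<in> K" and x: "x \<in> carrier X" for k x
    proof -
      obtain a b where "x = \<phi> (a, b)" and K: "a \<in> K" "b \<in> K"
        using x by auto
      then show ?thesis
        using Y.smult_assoc1[of k "a + b" y\<^sub>0] y0 k by (simp add: T_phi distrib_left)
    qed
  qed
  have half: "of_real (1/2) \<in> K" by (rule K_closed(1))
  \<comment> \<open>The supremum is attained at \<open>(1/2, 1/2)\<close>; the upper bound holds
    because \<open>pair_norm q\<close> dominates the \<open>\<ell>\<^sub>1\<close> norm.\<close>
  have "op_norm X Y T = 1"
    unfolding op_norm_def
  proof (rule cSup_eq_maximum)
    have "nrm Y (T (\<phi> (of_real (1/2), of_real (1/2)))) = 1"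
      unfolding nrm_T[OF half half] by simp
    moreover have "nrm X (\<phi> (of_real (1/2), of_real (1/2))) = 1"
      using pair_norm_diagonal[OF q, of "of_real (1/2)" "of_real (1/2)"] by simp
    moreover have "\<phi> (of_real (1/2), of_real (1/2)) \<in> carrier X" using half by simp
    ultimately show "1 \<in> (\<lambda>x. nrm Y (T x)) ` {x \<in> carrier X. nrm X x \<le> 1}"
      by (metis (mono_tags, lifting) image_eqI mem_Collect_eq order_refl)
  qed (use T_le in fastforce)
  then have T_sphere: "T \<in> operator_sphere K X Y"
    using T_bounded by (simp add: operator_sphere_def)
  define n where "n = pair_norm q (1, - of_real r)"
  have n_ge: "1 + r \<le> n" and n_le: "n \<le> (1 + q) * (1 + r)"
    using pair_norm_ge[OF q, of "(1, - of_real r)"] pair_norm_le[OF q, of "(1, - of_real r)"] r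
    by (simp_all add: n_def)
  then have n: "0 < n" using r by simp
  let ?v = "\<phi> (1, - of_real r)"
  define x\<^sub>0 where "x\<^sub>0 = of_real (1 / n) \<odot>\<^bsub>X\<^esub> ?v"
  have v: "?v \<in> carrier X" by simp
  have apply_x0: "nrm Y (S x\<^sub>0) = nrm Y (S ?v) / n" if "S \<in> bounded_operators K X Y" for S
  proof -
    have "S x\<^sub>0 = of_real (1 / n) \<odot>\<^bsub>Y\<^esub> S ?v" and "S ?v \<in> carrier Y"
      using that v K_closed(1) unfolding x\<^sub>0_def bounded_operators_def by blast+
    then show ?thesis
      using n Y.nrm_smult[OF K_closed(1)] by (simp add: norm_divide del: of_real_divide)
  qed
  have x0: "x\<^sub>0 \<in> unit_sphere X"
  proof -
    interpret X: normed_space K X by (rule normed_space)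
    show ?thesis
      using n v X.smult_closed[of "of_real (1 / n)" ?v] X.nrm_smult[of "of_real (1 / n)" ?v]
      unfolding unit_sphere_def x\<^sub>0_def
      by (simp add: n_def norm_divide zero_prod_def del: of_real_divide X_simps(1-4))
  qed
  \<comment> \<open>As \<open>q \<le> r\<close>, the norm \<open>n\<close> is at most
    \<open>(1 + r)\<^sup>2\<close>, and \<open>(1 - 3 * r) * (1 + r)\<^sup>2 \<le> 1 - r\<close>;
    this explains the condition \<open>3 * r < \<delta>\<close>. For \<open>\<delta> \<ge> 1\<close>
    the left side is not positive and the claim is clear.\<close>
  have "1 - \<delta> < (1 - r) / n"
  proof (cases "1 - \<delta> \<le> 0")
    case True
    then show ?thesis using n r by (smt (verit) divide_pos_pos)
  next
    case False
    have "(1 - \<delta>) * n \<le> (1 - \<delta>) * ((1 + r) * (1 + r))"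
    proof (rule mult_left_mono)
      have "(1 + q) * (1 + r) \<le> (1 + r) * (1 + r)" using r by (intro mult_right_mono) auto
      then show "n \<le> (1 + r) * (1 + r)" using n_le by simp
    qed (use False in simp)
    also have "\<dots> < (1 - 3 * r) * ((1 + r) * (1 + r))"
      using r by (intro mult_strict_right_mono) auto
    also have "\<dots> = 1 - r - 5 * (r * r) - 3 * (r * r * r)" by (simp add: algebra_simps)
    also have "\<dots> \<le> 1 - r"
    proof -
      have "0 \<le> r * r" "0 \<le> r * r * r" using r by simp_all
      then show ?thesis by linarith
    qed
    finally show ?thesis using n by (simp add: field_simps)
  qed
  moreover have "nrm Y (T x\<^sub>0) = (1 - r) / n"
  proof -
    have "1 + - complex_of_real r = of_real (1 - r)" by simp
    then have "cmod (1 + - of_real r) = 1 - r" using r by (simp only: norm_of_real)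
    then show ?thesis using apply_x0[OF T_bounded] nrm_T[of 1 "- of_real r"] by simp
  qed
  ultimately have T_x0: "1 - \<delta> < nrm Y (T x\<^sub>0)" by simp
  have no_S: "nrm Y (S x\<^sub>0) \<noteq> 1"
    if S: "S \<in> operator_sphere K X Y" and "op_norm X Y (op_diff X Y S T) < \<epsilon>" for S
  proof -
    have S': "S \<in> bounded_operators K X Y" "op_norm X Y S \<le> 1"
      using S by (auto simp: operator_sphere_def)
    have "T (\<phi> (1, - 1)) = \<zero>\<^bsub>Y\<^esub>" using T_phi[of 1 "- 1"] Y.smult_l_null[OF y0(1)] by simp
    then have "nrm Y (S ?v) < 1 + r"
      using nrm_apply_less[OF pairs Y q r(1) _ r(4) S'(1) T_bounded S'(2)] that(2) r by simp
    \<comment> \<open>The lower bound \<open>1 + r \<le> n\<close> meets the strict bound on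
      \<open>S ?v\<close>.\<close>
    then have "nrm Y (S ?v) / n < 1" using n n_ge by (simp add: divide_less_eq)
    then show ?thesis using apply_x0[OF S'(1)] by linarith
  qed
  show ?thesis
    unfolding pointwise_BPB_modulus_def
  proof (rule Sup_least)
    fix a assume "a \<in> insert 0 {ennreal \<rho> | \<rho>. \<rho> > 0 \<and>
     (\<forall>T\<in>operator_sphere K X Y. \<forall>x\<^sub>0\<in>unit_sphere X. nrm Y (T x\<^sub>0) > 1 - \<rho> \<longrightarrow>
       (\<exists>S\<in>operator_sphere K X Y. nrm Y (S x\<^sub>0) = 1 \<and> op_norm X Y (op_diff X Y S T) < \<epsilon>))}"
    then consider "a = 0" | \<rho> where "a = ennreal \<rho>" "\<rho> > 0"
      "nrm Y (T x\<^sub>0) > 1 - \<rho> \<longrightarrow>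
        (\<exists>S\<in>operator_sphere K X Y. nrm Y (S x\<^sub>0) = 1 \<and> op_norm X Y (op_diff X Y S T) < \<epsilon>)"
      using T_sphere x0 by blast
    then show "a \<le> ennreal \<delta>"
    proof cases
      case 2
      then have "\<not> 1 - \<rho> < nrm Y (T x\<^sub>0)" using no_S by blast
      then show ?thesis using T_x0 2(1) by (auto intro: ennreal_leI)
    qed simp
  qed
qed

section \<open>Conclusion for arbitrarily small \<open>\<delta>\<close>\<close>

theorem corollary2p10:
  fixes K :: "complex set" and Y :: "'y normed_module" and \<epsilon> :: real
  assumes "at_least_continuum TYPE('u)"
    and "K = \<real> \<or> K = UNIV"
    and "banach_space K Y"
    and "carrier Y \<noteq> {\<zero>\<^bsub>Y\<^esub>}"
    and "0 < \<epsilon>" and "\<epsilon> < 1"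
  shows "(INF X\<in>{X :: 'u normed_module. banach_space K X \<and> uniformly_smooth X}.
           pointwise_BPB_modulus K X Y \<epsilon>) = 0"
proof -
  interpret Y: banach_space K Y by fact
  obtain \<phi> :: "complex \<times> complex \<Rightarrow> 'u" where \<phi>: "inj \<phi>"
    using ex_inj_pairs[OF assms(1)] by blast
  have "(INF X\<in>{X :: 'u normed_module. banach_space K X \<and> uniformly_smooth X}.
      pointwise_BPB_modulus K X Y \<epsilon>) \<le> 0 + ennreal \<delta>" if \<delta>: "0 < \<delta>" for \<delta>
  proof -
    \<comment> \<open>The bound \<open>\<delta> / 4\<close> ensures \<open>3 * r < \<delta>\<close>,
      and \<open>1/2\<close> keeps \<open>r < 1\<close> and \<open>q \<le> 1/2\<close>. The value of
      \<open>q\<close> is the largest that the estimate allows.\<close>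
    define r where "r = min (1/2) (\<delta> / 4)"
    define q where "q = r * (1 - \<epsilon>)"
    have r: "0 < r" "3 * r < \<delta>" "r \<le> 1/2" using \<delta> by (auto simp: r_def)
    have q: "0 < q" "q \<le> r" using r assms(5,6) by (auto simp: q_def mult_le_cancel_left1)
    then have q2: "q \<le> 1/2" using r by simp
    have pairs: "normed_pairs \<phi> K (pair_norm q) 4"
    proof
      fix z :: "complex \<times> complex"
      have "norm z \<le> cmod (fst z) + cmod (snd z)"
        using norm_Pair_le[of "fst z" "snd z"] by simp
      then show "norm z \<le> pair_norm q z" using pair_norm_ge[OF q(1) q2, of z] by linarith
      have "cmod (fst z) \<le> norm z" "cmod (snd z) \<le> norm z"
        by (metis norm_fst_le prod.collapse, metis norm_snd_le prod.collapse)
      \<comment> \<open>The constant 4 is a factor 2 bounding \<open>1 + q\<close> times a factor 2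
        from the two coordinates.\<close>
      then have "(1 + q) * (cmod (fst z) + cmod (snd z)) \<le> 2 * (norm z + norm z)"
        using q q2 by (intro mult_mono) auto
      then show "pair_norm q z \<le> 4 * norm z" using pair_norm_le[OF q(1) q2, of z] by simp
    qed (use \<phi> assms(2) Y.R.is_cring in \<open>auto intro: pair_norm_scale pair_norm_triangle\<close>)
    interpret normed_pairs \<phi> K "pair_norm q" 4 by (rule pairs)
    have "pointwise_BPB_modulus K X Y \<epsilon> \<le> ennreal \<delta>"
      using r q q2 by (intro pair_space_modulus_le[OF pairs Y.normed_space_axioms assms(4)])
        (auto simp: q_def)
    moreover have "uniformly_smooth X"
      by (rule pair_space_uniformly_smooth[OF pairs q(1) q2])
    ultimately show ?thesis
      using banach_space by (intro INF_lower2[of X]) auto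
  qed
  then have "(INF X\<in>{X :: 'u normed_module. banach_space K X \<and> uniformly_smooth X}.
      pointwise_BPB_modulus K X Y \<epsilon>) \<le> 0"
    by (rule ennreal_le_epsilon)
  then show ?thesis by simp
qed

end
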